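(* A $2\times2$ matrix function $\Psi(z)$ is a solution of the model Riemann–Hilbert problem stated in the context if and only if there exist $x,y\in\mathbb{C}$ such that $$\Psi(z)=\left(\mathbf 1+\frac{1}{z}\begin{bmatrix} x & -x \\ y & -y \end{bmatrix}\right)\left(\frac{z^2-1}{z^2}\right)^{\sigma_1/4}.$$
   Context: $\mathbf 1$ is the $2\times2$ identity matrix, $\sigma_1=\begin{bmatrix}0&1\\1&0\end{bmatrix}$. Model Riemann–Hilbert problem: find a $2\times2$ matrix $\Psi(z)$, analytic on $\overline{\mathbb{C}}\setminus [-1,1]$, satisfying $\Psi_+(z)=\Psi_-(z)(-i\sigma_1)$ for $z\in[-1,0]$; $\Psi_+(z)=\Psi_-(z)(i\sigma_1)$ for $z\in[0,1]$; $\Psi(z)=O(|z\mp1|^{-1/4})$ as $z\to\pm1$; $\Psi(z)=O(|z|^{-1/2})$ as $z\to0$; $\Psi(z)=\mathbf 1+O(z^{-1})$ as $z\to\infty$. Here $\Psi_\pm$ are the boundary values from the upper/lower half-plane. With $\beta(z)=\left(\frac{z^2-1}{z^2}\right)^{1/4}$ analytic on $\overline{\mathbb C}\setminus[-1,1]$, $\beta(\infty)=1$, one sets $\left(\frac{z^2-1}{z^2}\right)^{\sigma_1/4}=\beta(z)^{\sigma_1}=\frac{\beta(z)}{2}\begin{bmatrix} 1 & 1 \\ 1 & 1 \end{bmatrix}+\frac{1}{2\beta(z)}\begin{bmatrix} 1 & -1 \\ -1 & 1 \end{bmatrix}$. *)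

theory Defs
  imports "HOL-Complex_Analysis.Complex_Analysis" "HOL-Library.Landau_Symbols"
begin

abbreviation branch_cut :: "complex set" where
  "branch_cut \<equiv> closed_segment (-1) 1"

abbreviation upper_half_plane :: "complex set" where
  "upper_half_plane \<equiv> {z. Im z > 0}"

abbreviation lower_half_plane :: "complex set" where
  "lower_half_plane \<equiv> {z. Im z < 0}"

definition mat2 :: "'a \<Rightarrow> 'a \<Rightarrow> 'a \<Rightarrow> 'a \<Rightarrow> 'a::zero^2^2" where
  "mat2 a b c d = vector [vector [a, b], vector [c, d]]"

definition smult_mat :: "'a::times \<Rightarrow> 'a^'n^'m \<Rightarrow> 'a^'n^'m"  (infixr "*\<^sub>m" 75) where
  "c *\<^sub>m A = map_matrix ((*) c) A"

definition \<sigma>\<^sub>1 :: "complex^2^2" where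
  "\<sigma>\<^sub>1 = mat2 0 1 1 0"

definition analytic_at_infinity :: "(complex \<Rightarrow> complex) \<Rightarrow> bool" where
  "analytic_at_infinity f \<longleftrightarrow>
     (\<exists>g. g analytic_on {0} \<and> (\<forall>\<^sub>F w in at 0. f (inverse w) = g w))"

text \<open>The jump matrix \<open>J x\<close> relates unrestricted limits from the two open half-planes
  (these limits are then automatically continuous along the interval).\<close>

definition has_jump :: "(complex \<Rightarrow> complex^2^2) \<Rightarrow> complex^2^2 \<Rightarrow> real \<Rightarrow> bool" where
  "has_jump \<Psi> J x \<longleftrightarrow>
     (\<exists>\<Psi>\<^sub>p \<Psi>\<^sub>m. (\<Psi> \<longlongrightarrow> \<Psi>\<^sub>p) (at (of_real x) within upper_half_plane) \<and>
              (\<Psi> \<longlongrightarrow> \<Psi>\<^sub>m) (at (of_real x) within lower_half_plane) \<and>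
              \<Psi>\<^sub>p = \<Psi>\<^sub>m ** J)"

text \<open>The jump conditions are imposed on the open intervals only: at \<open>-1\<close>, \<open>0\<close> and \<open>1\<close> the
  function may be unbounded and its behaviour is prescribed by the growth conditions.
  The values of \<open>\<Psi>\<close> on the cut are irrelevant.\<close>

definition solves_model_RHP :: "(complex \<Rightarrow> complex^2^2) \<Rightarrow> bool" where
  "solves_model_RHP \<Psi> \<longleftrightarrow>
     (\<forall>i j. (\<lambda>z. \<Psi> z $ i $ j) analytic_on (- branch_cut)) \<and>
     (\<forall>i j. analytic_at_infinity (\<lambda>z. \<Psi> z $ i $ j)) \<and>
     (\<forall>x\<in>{-1<..<0}. has_jump \<Psi> ((- \<i>) *\<^sub>m \<sigma>\<^sub>1) x) \<and>
     (\<forall>x\<in>{0<..<1}. has_jump \<Psi> (\<i> *\<^sub>m \<sigma>\<^sub>1) x) \<and>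
     (\<lambda>z. norm (\<Psi> z)) \<in> O[at 1 within (- branch_cut)](\<lambda>z. norm (z - 1) powr (- 1 / 4)) \<and>
     (\<lambda>z. norm (\<Psi> z)) \<in> O[at (-1) within (- branch_cut)](\<lambda>z. norm (z + 1) powr (- 1 / 4)) \<and>
     (\<lambda>z. norm (\<Psi> z)) \<in> O[at 0 within (- branch_cut)](\<lambda>z. norm z powr (- 1 / 2)) \<and>
     (\<lambda>z. norm (\<Psi> z - mat 1)) \<in> O[at_infinity](\<lambda>z. norm (inverse z))"

text \<open>Off the cut, \<open>(z\<^sup>2 - 1) / z\<^sup>2\<close> avoids the nonpositive reals, so the principal branch of the
  fourth root is the one that is analytic there with value \<open>1\<close> at infinity; see the lemmas below.\<close>

definition \<beta> :: "complex \<Rightarrow> complex" where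
  "\<beta> z = ((z\<^sup>2 - 1) / z\<^sup>2) powr (1 / 4)"

definition \<beta>_pow_\<sigma>\<^sub>1 :: "complex \<Rightarrow> complex^2^2" where
  "\<beta>_pow_\<sigma>\<^sub>1 z = (\<beta> z / 2) *\<^sub>m mat2 1 1 1 1 + (1 / (2 * \<beta> z)) *\<^sub>m mat2 1 (-1) (-1) 1"

lemma in_cut_iff: "z \<in> branch_cut \<longleftrightarrow> Im z = 0 \<and> \<bar>Re z\<bar> \<le> 1"
proof
  assume "z \<in> branch_cut"
  then obtain u where u: "0 \<le> u" "u \<le> 1" "z = (1 - u) *\<^sub>R (-1) + u *\<^sub>R 1"
    by (auto simp: in_segment)
  then show "Im z = 0 \<and> \<bar>Re z\<bar> \<le> 1" by auto
next
  assume z: "Im z = 0 \<and> \<bar>Re z\<bar> \<le> 1"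
  then have "z = (1 - (Re z + 1) / 2) *\<^sub>R (-1) + ((Re z + 1) / 2) *\<^sub>R 1"
    by (auto simp: complex_eq_iff field_simps)
  moreover have "0 \<le> (Re z + 1) / 2" "(Re z + 1) / 2 \<le> 1" using z by auto
  ultimately show "z \<in> branch_cut" unfolding in_segment by blast
qed

lemma radicand_notin_nonpos:
  assumes "z \<notin> branch_cut"
  shows "(z\<^sup>2 - 1) / z\<^sup>2 \<notin> \<real>\<^sub>\<le>\<^sub>0"
proof
  assume "(z\<^sup>2 - 1) / z\<^sup>2 \<in> \<real>\<^sub>\<le>\<^sub>0"
  then obtain r where r: "r \<le> 0" "(z\<^sup>2 - 1) / z\<^sup>2 = of_real r"
    by (auto elim: nonpos_Reals_cases)
  have z0: "z \<noteq> 0" using assms by (auto simp: in_cut_iff)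
  have "z\<^sup>2 * of_real (1 - r) = 1"
    using r(2) z0 by (simp add: field_simps)
  then have sq: "z\<^sup>2 = of_real (1 / (1 - r))"
    using r(1) by (simp add: field_simps)
  define s where "s = sqrt (1 / (1 - r))"
  have "z\<^sup>2 = (of_real s)\<^sup>2"
    using r(1) sq unfolding s_def of_real_power [symmetric] by simp
  then have "z = of_real s \<or> z = - of_real s" by (simp add: power2_eq_iff)
  moreover have "0 \<le> s" "s \<le> 1" using r(1) by (auto simp: s_def)
  ultimately show False using assms by (auto simp: in_cut_iff)
qed

lemma \<beta>_analytic: "\<beta> analytic_on (- branch_cut)"
  unfolding \<beta>_def
  by (intro analytic_intros) (use radicand_notin_nonpos in \<open>auto simp: in_cut_iff\<close>)

lemma \<beta>_pow4:
  assumes "z \<notin> branch_cut"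
  shows "\<beta> z ^ 4 = (z\<^sup>2 - 1) / z\<^sup>2"
proof -
  have "(z\<^sup>2 - 1) / z\<^sup>2 \<noteq> 0" using radicand_notin_nonpos [OF assms] by auto
  then show ?thesis
    unfolding \<beta>_def by (simp add: powr_def flip: exp_of_nat_mult)
qed

lemma \<beta>_inverse:
  assumes "w \<noteq> 0"
  shows "\<beta> (inverse w) = (1 - w\<^sup>2) powr (1 / 4)"
proof -
  have "((inverse w)\<^sup>2 - 1) / (inverse w)\<^sup>2 = 1 - w\<^sup>2"
    using assms by (simp add: power_inverse diff_divide_distrib left_diff_distrib divide_inverse)
  then show ?thesis by (simp add: \<beta>_def)
qed

lemma \<beta>_analytic_at_infinity: "analytic_at_infinity \<beta>"
  unfolding analytic_at_infinity_def
proof (intro exI conjI)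
  show "(\<lambda>w. (1 - w\<^sup>2) powr (1 / 4)) analytic_on {0::complex}"
    by (intro analytic_intros) auto
  show "\<forall>\<^sub>F w in at 0. \<beta> (inverse w) = (1 - w\<^sup>2) powr (1 / 4)"
    using \<beta>_inverse by (auto simp: eventually_at_filter)
qed

lemma \<beta>_tendsto_1: "(\<beta> \<longlongrightarrow> 1) at_infinity"
proof -
  have "((\<lambda>w::complex. (1 - w\<^sup>2) powr (1 / 4)) \<longlongrightarrow> (1 - 0\<^sup>2) powr (1 / 4)) (at 0)"
    by (intro tendsto_intros) auto
  moreover have "\<forall>\<^sub>F w in at 0. \<beta> (inverse w) = (1 - w\<^sup>2) powr (1 / 4)"
    using \<beta>_inverse by (auto simp: eventually_at_filter)
  ultimately have "((\<lambda>w. \<beta> (inverse w)) \<longlongrightarrow> 1) (at 0)"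
    by (subst tendsto_cong) auto
  then show ?thesis by (simp add: lim_at_infinity_0 o_def)
qed

lemma \<beta>_unique:
  assumes f: "continuous_on (- branch_cut) f" "\<And>z. z \<notin> branch_cut \<Longrightarrow> f z ^ 4 = (z\<^sup>2 - 1) / z\<^sup>2"
    and lim: "(f \<longlongrightarrow> 1) at_infinity" and z: "z \<notin> branch_cut"
  shows "f z = \<beta> z"
proof -
  have nz: "\<beta> z \<noteq> 0" if "z \<notin> branch_cut" for z
    using \<beta>_pow4 [OF that] radicand_notin_nonpos [OF that] by auto
  define h where "h = (\<lambda>z. f z / \<beta> z)"
  have "continuous_on (- branch_cut) h"
    unfolding h_def using nz f(1) \<beta>_analytic
    by (intro continuous_intros) (auto intro: holomorphic_on_imp_continuous_on analytic_imp_holomorphic)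
  moreover have "h ` (- branch_cut) \<subseteq> {w. w ^ 4 = 1}"
  proof
    fix w assume "w \<in> h ` (- branch_cut)"
    then obtain z where z: "z \<notin> branch_cut" "w = h z" by auto
    have "f z ^ 4 = \<beta> z ^ 4" using f(2) [OF z(1)] \<beta>_pow4 [OF z(1)] by simp
    then show "w \<in> {w. w ^ 4 = 1}"
      using nz [OF z(1)] z(2) by (simp add: h_def power_divide)
  qed
  then have "finite (h ` (- branch_cut))"
    by (rule finite_subset) (rule finite_roots_unity, simp)
  moreover have "connected (- branch_cut)"
    by (intro connected_complement_bounded_convex) (simp_all add: bounded_closed_segment)
  ultimately have "h constant_on (- branch_cut)"
    by (intro continuous_finite_range_constant)
  then obtain c where c: "\<And>z. z \<notin> branch_cut \<Longrightarrow> h z = c"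
    by (auto simp: constant_on_def)
  have "(h \<longlongrightarrow> 1 / 1) at_infinity"
    unfolding h_def by (intro tendsto_intros lim \<beta>_tendsto_1) auto
  moreover have "\<forall>\<^sub>F z in at_infinity. h z = c"
  proof -
    have "\<forall>\<^sub>F z::complex in at_infinity. z \<notin> branch_cut"
      unfolding eventually_at_infinity
    proof (intro exI allI impI)
      fix z :: complex assume "2 \<le> norm z"
      then show "z \<notin> branch_cut" using cmod_eq_Re [of z] by (auto simp: in_cut_iff)
    qed
    then show ?thesis by (rule eventually_mono) (rule c)
  qed
  ultimately have "((\<lambda>_. c) \<longlongrightarrow> 1 / 1) (at_infinity :: complex filter)"
    by (rule Lim_transform_eventually)
  then have "c = 1"
    using tendsto_unique [OF trivial_limit_at_infinity tendsto_const] by fastforce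
  then show ?thesis using c [OF z] nz [OF z] by (simp add: h_def)
qed

end

theory Submission
  imports Defs
begin

text \<open>If \<open>(a, b)\<close> is a row of a solution, then \<open>(a + b) / \<beta>\<close> and \<open>(a - b) * \<beta>\<close> have no jump, because the jump
  matrix swaps \<open>a\<close> and \<open>b\<close> up to the factor \<open>\<plusminus>\<i>\<close> by which \<open>\<beta>\<close> itself jumps. Multiplied by \<open>z\<^sup>2 * (z\<^sup>2 - 1)\<close> they
  therefore extend to entire functions; by the growth conditions these vanish at \<open>0\<close> and \<open>\<plusminus>1\<close> and grow
  like \<open>z ^ 4\<close>, so by Liouville they are \<open>z * (z\<^sup>2 - 1)\<close> times a linear polynomial. Hence both quotients
  have the form \<open>L + c / z\<close>, with \<open>c = 0\<close> for the first one, whose singularity at \<open>0\<close> is too weak for a pole.\<close>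

unbundle no Formal_Power_Series.fps_syntax

section \<open>Extension across the real line and the resulting rational form\<close>

lemma not_in_cut: "Im z \<noteq> 0 \<Longrightarrow> z \<in> - branch_cut"
  by (simp add: in_cut_iff)

lemma closure_nonreal: "z \<in> closure {z. Im z \<noteq> 0}"
  unfolding closure_approachable
proof (intro allI impI)
  fix e :: real assume "e > 0"
  then have "dist (Complex (Re z) (if Im z = 0 then e / 2 else Im z)) z < e"
    by (cases z) (auto simp: dist_norm complex_diff cmod_def)
  with \<open>e > 0\<close> show "\<exists>y\<in>{z. Im z \<noteq> 0}. dist y z < e"
    by (intro bexI[of _ "Complex (Re z) (if Im z = 0 then e / 2 else Im z)"]) auto
qed

text \<open>Nonreal points accumulate at every point of the plane, so limits taken along them are
  unique everywhere. This lets the extension below be defined by one formula on the whole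
  plane.\<close>

lemma at_within_nonreal_neq_bot: "at z within {z. Im z \<noteq> 0} \<noteq> bot"
proof (cases "Im z = 0")
  case True
  then show ?thesis
    using closure_nonreal[of z] by (auto simp: closure_def trivial_limit_within)
next
  case False
  moreover have "open {z. Im z \<noteq> 0}"
    by (intro open_Collect_neq continuous_intros)
  ultimately have "at z within {z. Im z \<noteq> 0} = at z"
    by (intro at_within_open) auto
  then show ?thesis by simp
qed

text \<open>The function of limits along nonreal points turns out to be continuous, and a continuous
  function that is holomorphic on both sides of a line is holomorphic across it. Only these limits
  enter, so the extension may differ from \<open>h\<close> on the real line.\<close>

lemma entire_extension_across_reals:
  assumes holo: "h holomorphic_on {z. Im z \<noteq> 0}"
    and lim: "\<And>x. Im x = 0 \<Longrightarrow> \<exists>l. (h \<longlongrightarrow> l) (at x within {z. Im z \<noteq> 0})"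
  obtains g where "g holomorphic_on UNIV" "\<And>z. (h \<longlongrightarrow> g z) (at z within {z. Im z \<noteq> 0})"
    "\<And>z. Im z \<noteq> 0 \<Longrightarrow> g z = h z"
proof -
  let ?S = "{z. Im z \<noteq> 0}"
  define g where "g = (\<lambda>z. Lim (at z within ?S) h)"
  have open_S: "open ?S"
    by (intro open_Collect_neq continuous_intros)
  have g_lim: "(h \<longlongrightarrow> g z) (at z within ?S)" for z
  proof -
    obtain l where "(h \<longlongrightarrow> l) (at z within ?S)"
      using lim[of z] holo by (cases "Im z = 0")
        (force dest!: holomorphic_on_imp_continuous_on simp: continuous_on_def)+
    then show ?thesis
      using at_within_nonreal_neq_bot[of z] by (simp add: g_def tendsto_Lim)
  qed
  have g_eq: "g z = h z" if "Im z \<noteq> 0" for z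
  proof -
    have "(h \<longlongrightarrow> h z) (at z within ?S)"
      using holo that by (auto dest!: holomorphic_on_imp_continuous_on simp: continuous_on_def)
    then show ?thesis
      using g_lim at_within_nonreal_neq_bot tendsto_unique by blast
  qed
  have "(g \<longlongrightarrow> g z) (at z)" for z
  proof (rule tendstoI)
    fix e :: real assume e: "e > 0"
    then have "\<forall>\<^sub>F w in at z within ?S. dist (h w) (g z) < e / 2"
      using g_lim[of z] by (intro tendstoD) auto
    then obtain d where d: "d > 0"
      "\<And>w. Im w \<noteq> 0 \<Longrightarrow> w \<noteq> z \<Longrightarrow> dist w z < d \<Longrightarrow> dist (h w) (g z) < e / 2"
      by (auto simp: eventually_at)
    \<comment> \<open>\<open>g w\<close> is itself a limit of values \<open>h v\<close> at nonreal
      \<open>v\<close> near \<open>w\<close>, hence within \<open>d\<close> of \<open>z\<close>. The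
      bound \<open>e / 2\<close> for \<open>h\<close> therefore passes to \<open>g\<close> as a weak
      inequality, and halving \<open>e\<close> makes it strict again.\<close>
    have "dist (g w) (g z) < e" if w: "w \<noteq> z" "dist w z < d" for w
    proof -
      have "((\<lambda>v. dist (h v) (g z)) \<longlongrightarrow> dist (g w) (g z)) (at w within ?S)"
        by (intro tendsto_intros g_lim)
      moreover have "\<forall>\<^sub>F v in at w within ?S. dist (h v) (g z) \<le> e / 2"
      proof -
        have "\<forall>\<^sub>F v in at w within ?S. v \<in> ball z d - {z}"
          using w by (intro topological_tendstoD[OF tendsto_ident_at])
            (auto simp: dist_commute)
        moreover have "\<forall>\<^sub>F v in at w within ?S. Im v \<noteq> 0"
          by (simp add: eventually_at_filter)
        ultimately show ?thesis
          by eventually_elim (use d(2) in \<open>force simp: dist_commute\<close>)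
      qed
      ultimately have "dist (g w) (g z) \<le> e / 2"
        using at_within_nonreal_neq_bot tendsto_upperbound by blast
      then show ?thesis using e by simp
    qed
    then show "\<forall>\<^sub>F w in at z. dist (g w) (g z) < e"
      using d(1) unfolding eventually_at by auto
  qed
  then have cont: "continuous_on UNIV g"
    by (simp add: continuous_on_def)
  have "g holomorphic_on {z. Im z \<noteq> 0}"
    using holomorphic_transform[OF holo] g_eq by simp
  then have "g holomorphic_on UNIV"
    \<comment> \<open>The line is the real axis, since the inner product with \<open>\<i>\<close> is
      the imaginary part.\<close>
    using cont by (intro holomorphic_on_paste_across_line[of UNIV \<i> g 0])
      (auto elim: holomorphic_on_subset)
  with g_lim g_eq that show ?thesis by blast
qed

text \<open>The points \<open>0\<close>, \<open>1\<close> and \<open>-1\<close> lie on the cut, so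
  they are not isolated singularities to begin with. After multiplication by
  \<open>z\<^sup>2 * (z\<^sup>2 - 1)\<close> all hypotheses become limits along nonreal points, as
  \<open>entire_extension_across_reals\<close> requires. The three zeros leave a quartic with two
  free coefficients, and \<open>L\<close> fixes one of them.\<close>

lemma rational_off_cut:
  assumes holo: "f holomorphic_on - branch_cut"
    and cut: "\<And>x::real. x \<in> {-1<..<1} - {0} \<Longrightarrow>
      \<exists>l. (f \<longlongrightarrow> l) (at (of_real x) within {z. Im z \<noteq> 0})"
    and p1: "((\<lambda>z. (z - 1) * f z) \<longlongrightarrow> 0) (at 1 within - branch_cut)"
    and m1: "((\<lambda>z. (z + 1) * f z) \<longlongrightarrow> 0) (at (-1) within - branch_cut)"
    and zero: "((\<lambda>z. z\<^sup>2 * f z) \<longlongrightarrow> 0) (at 0 within - branch_cut)"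
    and inf: "(f \<longlongrightarrow> L) at_infinity"
  obtains c where "\<And>z. z \<in> - branch_cut \<Longrightarrow> f z = L + c / z"
proof -
  let ?S = "{z. Im z \<noteq> 0}"
  define h where "h = (\<lambda>z. z\<^sup>2 * (z\<^sup>2 - 1) * f z)"
  have h_holo: "h holomorphic_on - branch_cut"
    unfolding h_def by (intro holomorphic_intros holo)
  have S_sub: "?S \<subseteq> - branch_cut"
    using not_in_cut by blast
  have lim_p1: "(h \<longlongrightarrow> 0) (at 1 within ?S)"
  proof -
    have "((\<lambda>z. z\<^sup>2 * (z + 1) * ((z - 1) * f z)) \<longlongrightarrow> 1\<^sup>2 * (1 + 1) * 0) (at 1 within ?S)"
      by (intro tendsto_intros tendsto_within_subset[OF p1 S_sub])
    then show ?thesis by (simp add: h_def algebra_simps power2_eq_square)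
  qed
  have lim_m1: "(h \<longlongrightarrow> 0) (at (-1) within ?S)"
  proof -
    have "((\<lambda>z. z\<^sup>2 * (z - 1) * ((z + 1) * f z)) \<longlongrightarrow> (-1)\<^sup>2 * (-1 - 1) * 0) (at (-1) within ?S)"
      by (intro tendsto_intros tendsto_within_subset[OF m1 S_sub])
    then show ?thesis by (simp add: h_def algebra_simps power2_eq_square)
  qed
  have lim_0: "(h \<longlongrightarrow> 0) (at 0 within ?S)"
  proof -
    have "((\<lambda>z. (z\<^sup>2 - 1) * (z\<^sup>2 * f z)) \<longlongrightarrow> (0\<^sup>2 - 1) * 0) (at 0 within ?S)"
      by (intro tendsto_intros tendsto_within_subset[OF zero S_sub])
    then show ?thesis by (simp add: h_def algebra_simps)
  qed
  have h_tendsto: "(h \<longlongrightarrow> h z) (at z within ?S)" if "z \<in> - branch_cut" for z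
    using holomorphic_on_imp_continuous_on[OF h_holo] that S_sub
    by (auto simp: continuous_on_def intro: tendsto_within_subset)
  have "\<exists>l. (h \<longlongrightarrow> l) (at x within ?S)" if x: "Im x = 0" for x
  proof -
    \<comment> \<open>A real point lies beyond the endpoints, where \<open>h\<close> is holomorphic,
      or is one of the three exceptional points, or lies inside one of the two jump
      intervals.\<close>
    consider "x \<in> - branch_cut" | "x = 0" | "x = 1" | "x = -1" | "x \<in> of_real ` ({-1<..<1} - {0})"
    proof -
      have "x = of_real (Re x)" using x by (simp add: complex_eq_iff)
      moreover have "Re x = 0 \<or> Re x = 1 \<or> Re x = -1 \<or> Re x \<in> {-1<..<1} - {0}"
        if "x \<in> branch_cut" using that by (auto simp: in_cut_iff)
      ultimately show ?thesis
        using that by (metis ComplI image_eqI of_real_0 of_real_1 of_real_minus)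
    qed
    then show ?thesis
    proof cases
      case 5
      then obtain l where "(f \<longlongrightarrow> l) (at x within ?S)" using cut by blast
      then have "(h \<longlongrightarrow> x\<^sup>2 * (x\<^sup>2 - 1) * l) (at x within ?S)"
        unfolding h_def by (intro tendsto_intros)
      then show ?thesis ..
    qed (use h_tendsto lim_0 lim_p1 lim_m1 in blast)+
  qed
  then obtain g where g: "g holomorphic_on UNIV" "\<And>z. (h \<longlongrightarrow> g z) (at z within ?S)"
    using entire_extension_across_reals[OF holomorphic_on_subset[OF h_holo S_sub]] by metis
  have g_eqI: "g z = l" if "(h \<longlongrightarrow> l) (at z within ?S)" for z l
    using that g(2) at_within_nonreal_neq_bot tendsto_unique by blast
  have g_roots: "g 0 = 0" "g 1 = 0" "g (-1) = 0"
    using lim_0 lim_p1 lim_m1 g_eqI by blast+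
  have g_eq: "g z = h z" if "z \<in> - branch_cut" for z
    using g_eqI h_tendsto that by blast
  have off_cut: "z \<in> - branch_cut" if "norm z > 1" for z
    using that cmod_eq_Re[of z] by (auto simp: in_cut_iff)
  obtain R where R: "\<And>z. norm z \<ge> R \<Longrightarrow> norm (f z - L) < 1"
    using tendstoD[OF inf, of 1] by (auto simp: eventually_at_infinity dist_norm)
  \<comment> \<open>Far out \<open>f\<close> is bounded by \<open>norm L + 1\<close>, so the weight
    of degree four dictates the growth. The threshold \<open>2\<close> secures both
    \<open>1 \<le> norm z ^ 2\<close> and that \<open>z\<close> is off the cut.\<close>
  have "norm (g z) \<le> 2 * (norm L + 1) * norm z ^ 4" if z: "max R 2 \<le> norm z" for z
  proof -
    have "norm (f z) \<le> norm L + 1"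
      using R[of z] z norm_triangle_ineq2[of "f z" L] by simp
    moreover have "1 \<le> norm z ^ 2"
      using z by (intro one_le_power) simp
    then have "norm (z\<^sup>2 - 1) \<le> 2 * norm z ^ 2"
      using norm_triangle_ineq4[of "z\<^sup>2" 1] by (simp add: norm_power)
    ultimately have "norm (z\<^sup>2) * norm (z\<^sup>2 - 1) * norm (f z)
        \<le> norm z ^ 2 * (2 * norm z ^ 2) * (norm L + 1)"
      by (intro mult_mono order_refl) (simp_all add: norm_power)
    then have "norm (h z) \<le> norm z ^ 2 * (2 * norm z ^ 2) * (norm L + 1)"
      by (simp add: h_def norm_mult)
    then show ?thesis
      using g_eq[OF off_cut[of z]] z by (simp add: algebra_simps flip: power_add)
  qed
  then have poly: "g z = (\<Sum>k\<le>4. (deriv ^^ k) g 0 / fact k * z ^ k)" for z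
    by (rule Liouville_polynomial[OF g(1)])
  define a where "a = (\<lambda>k. (deriv ^^ k) g 0 / fact k)"
  have poly: "g z = a 0 + a 1 * z + a 2 * z\<^sup>2 + a 3 * z ^ 3 + a 4 * z ^ 4" for z
    using poly[of z] by (simp add: a_def numeral_eq_Suc)
  have "a 0 = 0" using poly[of 0] g_roots by simp
  with poly[of 1] g_roots have "a 1 + a 2 + a 3 + a 4 = 0"
    by simp
  moreover have "- a 1 + a 2 - a 3 + a 4 = 0"
    using poly[of "-1"] g_roots \<open>a 0 = 0\<close> by simp
  \<comment> \<open>Adding the conditions at \<open>1\<close> and \<open>-1\<close> separates the
    even coefficients from the odd ones.\<close>
  moreover have "p + r = 0 \<and> q + s = 0" if "p + q + r + s = 0" "- p + q - r + s = 0"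
    for p q r s :: complex
  proof -
    have "2 * (q + s) = (p + q + r + s) + (- p + q - r + s)" by simp
    also have "\<dots> = 0" using that by simp
    finally have "q + s = 0" unfolding mult_eq_0_iff by simp
    moreover have "p + r = (p + q + r + s) - (q + s)" by simp
    ultimately show ?thesis using that(1) by simp
  qed
  ultimately have "a 1 + a 3 = 0" "a 2 + a 4 = 0"
    by blast+
  with \<open>a 0 = 0\<close> have a: "a 0 = 0" "a 1 = - a 3" "a 2 = - a 4"
    by (simp_all add: eq_neg_iff_add_eq_0)
  have f_eq: "f z = a 4 + a 3 / z" if z: "z \<in> - branch_cut" for z
  proof -
    have nz: "z \<noteq> 0" "z\<^sup>2 - 1 \<noteq> 0"
      using z by (auto simp: in_cut_iff power2_eq_1_iff)
    have "g z = (z\<^sup>2 - 1) * z * (a 4 * z + a 3)"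
      unfolding poly a by (simp add: algebra_simps eval_nat_numeral)
    moreover have "g z = (z\<^sup>2 - 1) * z * (z * f z)"
      unfolding g_eq[OF z] h_def by (simp add: power2_eq_square)
    ultimately have "z * f z = a 4 * z + a 3"
      using nz by simp
    then show ?thesis using nz by (simp add: field_simps)
  qed
  \<comment> \<open>Uniqueness of the limit at infinity identifies \<open>a 4\<close> with
    \<open>L\<close>; the remaining coefficient \<open>a 3\<close> is the constant
    \<open>c\<close>.\<close>
  have "((\<lambda>z. a 4 + a 3 / z) \<longlongrightarrow> a 4 + 0) at_infinity"
    by (intro tendsto_intros tendsto_divide_0[OF tendsto_const] filterlim_ident)
  moreover have "\<forall>\<^sub>F z in at_infinity. a 4 + a 3 / z = f z"
    unfolding eventually_at_infinity using f_eq off_cut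
    by (intro exI[of _ 2]) force
  ultimately have "(f \<longlongrightarrow> a 4) at_infinity"
    using Lim_transform_eventually by force
  then have "L = a 4"
    using inf tendsto_unique trivial_limit_at_infinity by blast
  with that[of "a 3"] f_eq show ?thesis by blast
qed

section \<open>Jump and growth of \<beta>\<close>

lemma \<beta>_nonzero:
  assumes "z \<in> - branch_cut"
  shows "\<beta> z \<noteq> 0"
  using \<beta>_pow4[of z] radicand_notin_nonpos[of z] assms by auto

text \<open>Squaring doubles the argument and inversion reverses it, so \<open>1 / z\<^sup>2\<close>
  stays in one half-plane on each open quadrant. That half-plane decides in which direction the
  logarithm is shifted below.\<close>

lemma Im_inverse_square_less_0_iff:
  fixes z :: complex
  shows "Im (1 / z\<^sup>2) < 0 \<longleftrightarrow> Re z * Im z > 0"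
    and "Im (1 / z\<^sup>2) > 0 \<longleftrightarrow> Re z * Im z < 0"
proof -
  have "Im (1 / z\<^sup>2) < 0 \<longleftrightarrow> Im (cnj (z\<^sup>2)) < 0" "Im (1 / z\<^sup>2) > 0 \<longleftrightarrow> Im (cnj (z\<^sup>2)) > 0"
    unfolding Im_complex_div_lt_0 Im_complex_div_gt_0 by simp_all
  moreover have "Im (cnj (z\<^sup>2)) = - 2 * (Re z * Im z)"
    by (simp add: Im_power2)
  ultimately show "Im (1 / z\<^sup>2) < 0 \<longleftrightarrow> Re z * Im z > 0" "Im (1 / z\<^sup>2) > 0 \<longleftrightarrow> Re z * Im z < 0"
    by linarith+
qed

text \<open>Crossing the cut amounts to turning the radicand across the negative real axis; factoring
  out \<open>-1\<close> leaves a root which is continuous there.\<close>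

lemma \<beta>_eq_cis:
  assumes "Re z * Im z \<noteq> 0"
  shows "\<beta> z = exp (sgn (Re z * Im z) * (\<i> * pi / 4)) * (1 / z\<^sup>2 - 1) powr (1 / 4)"
proof -
  define t where "t = 1 / z\<^sup>2 - 1"
  have z: "z \<noteq> 0" using assms by auto
  have Im_t: "Im t < 0 \<longleftrightarrow> Re z * Im z > 0" "Im t > 0 \<longleftrightarrow> Re z * Im z < 0"
    using Im_inverse_square_less_0_iff[of z] by (simp_all add: t_def)
  have "t \<noteq> 0"
    using Im_t assms by auto
  moreover have "(z\<^sup>2 - 1) / z\<^sup>2 = - t"
    using z by (simp add: t_def field_simps)
  \<comment> \<open>\<open>Ln_minus\<close> adds \<open>\<i> * pi\<close> for \<open>t\<close> below
    the real axis and subtracts it above; a quarter of this shift is the phase of the claim.\<close>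
  moreover have "Ln (- t) = Ln t + sgn (Re z * Im z) * (\<i> * pi)"
    using Ln_minus[OF \<open>t \<noteq> 0\<close>] Im_t assms by (cases "Re z * Im z > 0") (auto simp: sgn_if)
  ultimately show ?thesis
    by (simp add: \<beta>_def powr_def exp_add flip: t_def) (simp add: field_simps flip: exp_add)
qed

lemma nonreal_eq_half_planes: "{z. Im z \<noteq> 0} = upper_half_plane \<union> lower_half_plane"
  by auto

text \<open>This is how equality of two boundary values becomes a single limit, the form in which
  the cut can be removed.\<close>

lemma tendsto_nonreal_iff:
  "(f \<longlongrightarrow> l) (at z within {z. Im z \<noteq> 0}) \<longleftrightarrow>
    (f \<longlongrightarrow> l) (at z within upper_half_plane) \<and> (f \<longlongrightarrow> l) (at z within lower_half_plane)"
  unfolding nonreal_eq_half_planes at_within_union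
  using filterlim_sup filterlim_mono[OF _ order_refl sup_ge1] filterlim_mono[OF _ order_refl sup_ge2]
  by blast

text \<open>The root \<open>r\<close> is continuous at \<open>x\<close>, where its radicand is
  positive. The whole jump sits in the phase from \<open>\<beta>_eq_cis\<close>, whose exponent
  \<open>\<i> * pi / 4\<close> takes opposite signs above and below; the quotient of the two phases
  is \<open>sgn x * \<i>\<close>.\<close>

lemma \<beta>_tendsto_cut:
  fixes x :: real
  assumes x: "x \<in> {-1<..<1} - {0}"
  obtains b where "b \<noteq> 0"
    "(\<beta> \<longlongrightarrow> (sgn x * \<i>) * b) (at (of_real x) within upper_half_plane)"
    "(\<beta> \<longlongrightarrow> b) (at (of_real x) within lower_half_plane)"
proof -
  define r where "r = (\<lambda>z::complex. (1 / z\<^sup>2 - 1) powr (1 / 4))"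
  have "1 / x\<^sup>2 - 1 > 0"
    using x by (simp add: field_simps abs_square_less_1 abs_if)
  moreover have radicand: "1 / (complex_of_real x)\<^sup>2 - 1 = complex_of_real (1 / x\<^sup>2 - 1)"
    by simp
  ultimately have nonpos: "1 / (complex_of_real x)\<^sup>2 - 1 \<notin> \<real>\<^sub>\<le>\<^sub>0"
    by (simp only: complex_nonpos_Reals_iff) auto
  then have r_nz: "r x \<noteq> 0" by (auto simp: r_def)
  have r_lim: "(r \<longlongrightarrow> r x) (at (of_real x) within S)" for S
    unfolding r_def using x nonpos by (intro tendsto_intros) auto
  \<comment> \<open>Near \<open>x\<close> the real part keeps the sign of \<open>x\<close>, so
    \<open>Re z * Im z\<close> has the sign of \<open>x\<close> above the axis and the opposite sign
    below.\<close>
  have near: "\<forall>\<^sub>F z in at (of_real x) within S. sgn (Re z) = sgn x" for S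
  proof -
    have "((\<lambda>z. Re z * x) \<longlongrightarrow> Re (of_real x) * x) (at (of_real x) within S)"
      by (intro tendsto_intros)
    then have "\<forall>\<^sub>F z in at (of_real x) within S. 0 < Re z * x"
      using x by (intro order_tendstoD(1)[where y = "Re (of_real x) * x"]) (auto simp: zero_less_mult_iff)
    then show ?thesis
      by eventually_elim (auto simp: zero_less_mult_iff)
  qed
  let ?e = "\<lambda>s. exp (complex_of_real s * (\<i> * pi / 4))"
  have up: "(\<beta> \<longlongrightarrow> ?e (sgn x) * r x) (at (of_real x) within upper_half_plane)"
  proof (rule Lim_transform_eventually)
    show "((\<lambda>z. ?e (sgn x) * r z) \<longlongrightarrow> ?e (sgn x) * r x) (at (of_real x) within upper_half_plane)"
      by (intro tendsto_intros r_lim)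
    have "\<forall>\<^sub>F z in at (of_real x) within upper_half_plane. Im z > 0"
      by (simp add: eventually_at_filter)
    with near[of upper_half_plane]
    show "\<forall>\<^sub>F z in at (of_real x) within upper_half_plane. ?e (sgn x) * r z = \<beta> z"
    proof eventually_elim
      case (elim z)
      then have "Re z * Im z \<noteq> 0" using x by (auto simp: sgn_zero_iff)
      with elim show ?case by (simp add: \<beta>_eq_cis r_def sgn_mult)
    qed
  qed
  have low: "(\<beta> \<longlongrightarrow> ?e (- sgn x) * r x) (at (of_real x) within lower_half_plane)"
  proof (rule Lim_transform_eventually)
    show "((\<lambda>z. ?e (- sgn x) * r z) \<longlongrightarrow> ?e (- sgn x) * r x) (at (of_real x) within lower_half_plane)"
      by (intro tendsto_intros r_lim)
    have "\<forall>\<^sub>F z in at (of_real x) within lower_half_plane. Im z < 0"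
      by (simp add: eventually_at_filter)
    with near[of lower_half_plane]
    show "\<forall>\<^sub>F z in at (of_real x) within lower_half_plane. ?e (- sgn x) * r z = \<beta> z"
    proof eventually_elim
      case (elim z)
      then have "Re z * Im z \<noteq> 0" using x by (auto simp: sgn_zero_iff)
      with elim show ?case by (simp add: \<beta>_eq_cis r_def sgn_mult)
    qed
  qed
  have "?e (sgn x) = exp (sgn x * (\<i> * pi / 2)) * ?e (- sgn x)"
    by (simp flip: exp_add add: field_simps)
  also have "exp (sgn x * (\<i> * pi / 2)) = sgn x * \<i>"
    using x by (auto simp: sgn_if exp_Euler simp flip: cis_conv_exp)
      (auto simp: exp_eq_polar complex_eq_iff Re_exp Im_exp)
  finally have "?e (sgn x) = (sgn x * \<i>) * ?e (- sgn x)" .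
  with up low r_nz show ?thesis
    by (intro that[of "?e (- sgn x) * r x"]) (auto simp: mult.assoc)
qed

text \<open>The modulus of a real power depends only on the modulus of the base, so the branch of
  the root drops out and the factors of \<open>z\<^sup>2 - 1\<close> separate.\<close>

lemma norm_\<beta>_power_int:
  fixes s :: int
  assumes "z \<noteq> 0" "z \<noteq> 1" "z \<noteq> -1"
  shows "norm (\<beta> z powi s) =
    norm (z - 1) powr (s / 4) * norm (z + 1) powr (s / 4) * norm z powr (- (s / 2))"
proof -
  have "z\<^sup>2 - 1 = (z - 1) * (z + 1)" by (simp add: power2_eq_square algebra_simps)
  then have "norm (\<beta> z) = (norm (z - 1) * norm (z + 1) / norm z ^ 2) powr (1 / 4)"
    by (simp add: \<beta>_def norm_powr_real_powr' norm_divide norm_mult norm_power)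
  moreover have "\<dots> > 0" using assms by (simp add: add_eq_0_iff2)
  ultimately have "norm (\<beta> z powi s) =
      ((norm (z - 1) * norm (z + 1) / norm z ^ 2) powr (1 / 4)) powr s"
    by (simp add: norm_power_int powr_real_of_int')
  also have "\<dots> = norm (z - 1) powr (s / 4) * norm (z + 1) powr (s / 4) / norm z powr (s / 2)"
  proof -
    have "norm z ^ 2 = norm z powr 2" using assms by simp
    then show ?thesis
      by (simp only: powr_mult powr_divide powr_powr) simp
  qed
  finally show ?thesis
    using powr_minus_divide[of "norm z" "s / 2"] by simp
qed

text \<open>At each of the three points only one factor in \<open>norm_\<beta>_power_int\<close>
  degenerates; the product of the others tends to a nonzero constant. An integer \<open>s\<close>
  covers \<beta> and its reciprocal at once, and terms such as \<open>z - 0\<close> are kept to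
  match a general centre \<open>p\<close>.\<close>

lemma bigtheta_\<beta>_power_int:
  fixes s :: int
  shows "(\<lambda>z. norm (\<beta> z powi s)) \<in> \<Theta>[at 1 within S](\<lambda>z. norm (z - 1) powr (s / 4))"
    and "(\<lambda>z. norm (\<beta> z powi s)) \<in> \<Theta>[at (-1) within S](\<lambda>z. norm (z - (-1)) powr (s / 4))"
    and "(\<lambda>z. norm (\<beta> z powi s)) \<in> \<Theta>[at 0 within S](\<lambda>z. norm (z - 0) powr (- (s / 2)))"
proof -
  have away: "\<forall>\<^sub>F z in at p within S. z \<noteq> q" for p q :: complex
  proof (cases "p = q")
    case False
    then show ?thesis by (intro tendsto_imp_eventually_ne[OF tendsto_ident_at])
  qed (simp add: eventually_at_filter)
  note ne = away[of 0] away[of 1] away[of "-1"]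
  show "(\<lambda>z. norm (\<beta> z powi s)) \<in> \<Theta>[at 1 within S](\<lambda>z. norm (z - 1) powr (s / 4))"
  proof (rule bigthetaI_tendsto[OF _ Lim_transform_eventually])
    show "((\<lambda>z. norm (z + 1) powr (s / 4) * norm z powr (- (s / 2))) \<longlongrightarrow>
        norm (1 + 1 :: complex) powr (s / 4) * norm (1 :: complex) powr (- (s / 2))) (at 1 within S)"
      by (intro tendsto_intros) auto
    show "\<forall>\<^sub>F z in at 1 within S. norm (z + 1) powr (s / 4) * norm z powr (- (s / 2)) =
        norm (\<beta> z powi s) / norm (z - 1) powr (s / 4)"
      using ne by eventually_elim (simp add: norm_\<beta>_power_int)
  qed simp
  show "(\<lambda>z. norm (\<beta> z powi s)) \<in> \<Theta>[at (-1) within S](\<lambda>z. norm (z - (-1)) powr (s / 4))"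
  proof (rule bigthetaI_tendsto[OF _ Lim_transform_eventually])
    show "((\<lambda>z. norm (z - 1) powr (s / 4) * norm z powr (- (s / 2))) \<longlongrightarrow>
        norm (-1 - 1 :: complex) powr (s / 4) * norm (-1 :: complex) powr (- (s / 2))) (at (-1) within S)"
      by (intro tendsto_intros) auto
    show "\<forall>\<^sub>F z in at (-1) within S. norm (z - 1) powr (s / 4) * norm z powr (- (s / 2)) =
        norm (\<beta> z powi s) / norm (z - (-1)) powr (s / 4)"
      using ne by eventually_elim (simp add: norm_\<beta>_power_int add_eq_0_iff2)
  qed simp
  show "(\<lambda>z. norm (\<beta> z powi s)) \<in> \<Theta>[at 0 within S](\<lambda>z. norm (z - 0) powr (- (s / 2)))"
  proof (rule bigthetaI_tendsto[OF _ Lim_transform_eventually])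
    show "((\<lambda>z. norm (z - 1) powr (s / 4) * norm (z + 1) powr (s / 4)) \<longlongrightarrow>
        norm (0 - 1 :: complex) powr (s / 4) * norm (0 + 1 :: complex) powr (s / 4)) (at 0 within S)"
      by (intro tendsto_intros) auto
    show "\<forall>\<^sub>F z in at 0 within S. norm (z - 1) powr (s / 4) * norm (z + 1) powr (s / 4) =
        norm (\<beta> z powi s) / norm (z - 0) powr (- (s / 2))"
      using ne by eventually_elim (simp add: norm_\<beta>_power_int)
  qed simp
qed

section \<open>Quotients by powers of \<beta>\<close>

text \<open>Adding exponents turns growth conditions into the vanishing limits that
  \<open>rational_off_cut\<close> asks for.\<close>

lemma tendsto_0_of_bigo_powr:
  fixes f g :: "complex \<Rightarrow> complex" and p :: complex
  assumes f: "(\<lambda>z. norm (f z)) \<in> O[at p within S](\<lambda>z. norm (z - p) powr a)"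
    and g: "(\<lambda>z. norm (g z)) \<in> O[at p within S](\<lambda>z. norm (z - p) powr b)"
    and pos: "a + b + real n > 0"
  shows "((\<lambda>z. (z - p) ^ n * (f z * g z)) \<longlongrightarrow> 0) (at p within S)"
proof -
  have "(\<lambda>z. norm (z - p) ^ n * (norm (f z) * norm (g z)))
      \<in> O[at p within S](\<lambda>z. norm (z - p) ^ n * (norm (z - p) powr a * norm (z - p) powr b))"
    by (intro landau_o.big.mult f g landau_o.big_refl)
  then obtain C where C: "\<forall>\<^sub>F z in at p within S. norm (norm (z - p) ^ n * (norm (f z) * norm (g z)))
      \<le> C * norm (norm (z - p) ^ n * (norm (z - p) powr a * norm (z - p) powr b))"
    by (elim landau_o.bigE)
  have "\<forall>\<^sub>F z in at p within S. z \<noteq> p"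
    by (simp add: eventually_at_filter)
  with C have bound: "\<forall>\<^sub>F z in at p within S. norm ((z - p) ^ n * (f z * g z))
      \<le> C * norm (z - p) powr (a + b + real n)"
    by eventually_elim (simp add: norm_mult norm_power powr_add abs_mult powr_realpow mult_ac)
  have "((\<lambda>z. C * norm (z - p) powr (a + b + real n)) \<longlongrightarrow> C * 0) (at p within S)"
  proof (intro tendsto_mult tendsto_const tendsto_zero_powrI)
    have "((\<lambda>z. norm (z - p)) \<longlongrightarrow> norm (p - p)) (at p within S)"
      by (intro tendsto_intros)
    then show "((\<lambda>z. norm (z - p)) \<longlongrightarrow> 0) (at p within S)" by simp
  qed (use pos in auto)
  then show ?thesis
    using Lim_null_comparison[OF bound] by simp
qed

text \<open>The case \<open>s = 1\<close> serves for the sum of the entries of a row,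
  \<open>s = -1\<close> for their difference. Crossing the cut upwards multiplies \<open>f\<close>
  by \<open>s * sgn x * \<i>\<close> and the power of \<beta> by
  \<open>(sgn x * \<i>) powi s\<close>. These factors agree for \<open>s = \<plusminus>1\<close>, so
  the quotient \<open>h\<close> has no jump.\<close>

lemma \<beta>_power_int_quotient:
  fixes s :: int
  assumes s: "s = 1 \<or> s = -1"
    and holo: "f holomorphic_on - branch_cut"
    and jump: "\<And>x::real. x \<in> {-1<..<1} - {0} \<Longrightarrow>
      \<exists>l. (f \<longlongrightarrow> of_int s * (sgn x * \<i>) * l) (at (of_real x) within upper_half_plane) \<and>
        (f \<longlongrightarrow> l) (at (of_real x) within lower_half_plane)"
    and p1: "(\<lambda>z. norm (f z)) \<in> O[at 1 within - branch_cut](\<lambda>z. norm (z - 1) powr (- 1 / 4))"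
    and m1: "(\<lambda>z. norm (f z)) \<in> O[at (-1) within - branch_cut](\<lambda>z. norm (z - (-1)) powr (- 1 / 4))"
    and zero: "(\<lambda>z. norm (f z)) \<in> O[at 0 within - branch_cut](\<lambda>z. norm (z - 0) powr (- 1 / 2))"
    and inf: "(f \<longlongrightarrow> L) at_infinity"
  obtains c where "\<And>z. z \<in> - branch_cut \<Longrightarrow> f z = (L + c / z) * \<beta> z powi s" "s = 1 \<Longrightarrow> c = 0"
proof -
  define h where "h = (\<lambda>z. f z * \<beta> z powi (- s))"
  have h_jump: "\<exists>l. (h \<longlongrightarrow> l) (at (of_real x) within {z. Im z \<noteq> 0})"
    if x: "x \<in> {-1<..<1} - {0}" for x :: real
  proof -
    obtain l where l: "(f \<longlongrightarrow> of_int s * (sgn x * \<i>) * l) (at (of_real x) within upper_half_plane)"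
      "(f \<longlongrightarrow> l) (at (of_real x) within lower_half_plane)"
      using jump[OF x] by blast
    obtain b where b: "b \<noteq> 0"
      "(\<beta> \<longlongrightarrow> (sgn x * \<i>) * b) (at (of_real x) within upper_half_plane)"
      "(\<beta> \<longlongrightarrow> b) (at (of_real x) within lower_half_plane)"
      using \<beta>_tendsto_cut[OF x] by blast
    have "(h \<longlongrightarrow> of_int s * (sgn x * \<i>) * l * ((sgn x * \<i>) * b) powi (- s))
        (at (of_real x) within upper_half_plane)"
      unfolding h_def using x b by (intro tendsto_mult l(1) tendsto_power_int') (auto simp: sgn_zero_iff)
    moreover have "of_int s * (sgn x * \<i>) * l * ((sgn x * \<i>) * b) powi (- s) = l * b powi (- s)"
      using s x b(1) by (auto simp: sgn_if power_int_minus field_simps)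
    moreover have "(h \<longlongrightarrow> l * b powi (- s)) (at (of_real x) within lower_half_plane)"
      unfolding h_def using b by (intro tendsto_mult l(2) tendsto_power_int') auto
    ultimately have "(h \<longlongrightarrow> l * b powi (- s)) (at (of_real x) within {z. Im z \<noteq> 0})"
      by (simp add: tendsto_nonreal_iff)
    then show ?thesis ..
  qed
  note growth = bigtheta_\<beta>_power_int[THEN bigthetaD1, of "- s"]
  have h_p1: "((\<lambda>z. (z - 1) * h z) \<longlongrightarrow> 0) (at 1 within - branch_cut)"
    using tendsto_0_of_bigo_powr[OF p1 growth(1), of 1] s by (auto simp: h_def)
  have h_m1: "((\<lambda>z. (z + 1) * h z) \<longlongrightarrow> 0) (at (-1) within - branch_cut)"
    using tendsto_0_of_bigo_powr[OF m1 growth(2), of 1] s by (auto simp: h_def)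
  \<comment> \<open>With \<open>- 1 / 2\<close> from \<open>f\<close> and \<open>s / 2\<close> from
    the power of \<beta>, the total exponent is \<open>n - (1 - s) / 2\<close>. Thus
    \<open>n = 2\<close> works for both values of \<open>s\<close>, and for \<open>s = 1\<close>
    already \<open>n = 1\<close>.\<close>
  have h_0: "((\<lambda>z. z ^ n * h z) \<longlongrightarrow> 0) (at 0 within - branch_cut)" if "real n > (1 - s) / 2" for n
    using tendsto_0_of_bigo_powr[OF zero growth(3), of n] that
    by (auto simp: h_def field_simps)
  have "(h \<longlongrightarrow> L * 1 powi (- s)) at_infinity"
    unfolding h_def by (intro tendsto_intros inf \<beta>_tendsto_1) simp
  then have h_inf: "(h \<longlongrightarrow> L) at_infinity" by simp
  have "h holomorphic_on - branch_cut"
    unfolding h_def using \<beta>_nonzero \<beta>_analytic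
    by (intro holomorphic_intros holo) (auto intro: analytic_imp_holomorphic)
  then obtain c where c: "\<And>z. z \<in> - branch_cut \<Longrightarrow> h z = L + c / z"
    using rational_off_cut[OF _ h_jump h_p1 h_m1 h_0 h_inf] s by force
  show ?thesis
  proof (rule that)
    fix z assume z: "z \<in> - branch_cut"
    show "f z = (L + c / z) * \<beta> z powi s"
      unfolding c[OF z, symmetric] h_def using \<beta>_nonzero[OF z] by (simp add: power_int_minus)
  next
    assume "s = 1"
    let ?S = "{z. Im z \<noteq> 0}"
    have sub: "?S \<subseteq> - branch_cut" using not_in_cut by blast
    \<comment> \<open>Along nonreal points \<open>z * h z\<close> tends to the residue
      \<open>c\<close>, while the sharper bound available for \<open>s = 1\<close> sends it to
      \<open>0\<close>.\<close>
    have "((\<lambda>z. z * h z) \<longlongrightarrow> 0) (at 0 within ?S)"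
      using tendsto_within_subset[OF h_0[of 1] sub] \<open>s = 1\<close> by simp
    moreover have "\<forall>\<^sub>F z in at 0 within ?S. z * h z = L * z + c"
      using c[OF not_in_cut] by (auto simp: eventually_at_filter field_simps intro!: always_eventually)
    ultimately have "((\<lambda>z. L * z + c) \<longlongrightarrow> 0) (at 0 within ?S)"
      by (rule Lim_transform_eventually)
    moreover have "((\<lambda>z. L * z + c) \<longlongrightarrow> L * 0 + c) (at 0 within ?S)"
      by (intro tendsto_intros)
    ultimately have "0 = L * 0 + c"
      by (intro tendsto_unique[OF at_within_nonreal_neq_bot])
    then show "c = 0" by simp
  qed
qed

section \<open>Entrywise form of the conditions\<close>

text \<open>Right multiplication by a multiple of \<open>\<sigma>\<^sub>1\<close> exchanges the
  columns and scales them, so the jump relates each row only to itself.\<close>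

lemma has_jump_iff:
  "has_jump \<Psi> (c *\<^sub>m \<sigma>\<^sub>1) x \<longleftrightarrow>
    (\<exists>p m. (\<forall>i j. ((\<lambda>z. \<Psi> z $ i $ j) \<longlongrightarrow> p i j) (at (of_real x) within upper_half_plane)) \<and>
      (\<forall>i j. ((\<lambda>z. \<Psi> z $ i $ j) \<longlongrightarrow> m i j) (at (of_real x) within lower_half_plane)) \<and>
      (\<forall>i. p i 1 = c * m i 2 \<and> p i 2 = c * m i 1))" (is "?L \<longleftrightarrow> ?R")
proof -
  have mult: "P = M ** (c *\<^sub>m \<sigma>\<^sub>1) \<longleftrightarrow> (\<forall>i. P $ i $ 1 = c * M $ i $ 2 \<and> P $ i $ 2 = c * M $ i $ 1)"
    for P M :: "complex^2^2"
    by (auto simp: vec_eq_iff forall_2 matrix_matrix_mult_def sum_2 \<sigma>\<^sub>1_def mat2_def smult_mat_def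
      mult.commute)
  show ?thesis
  proof
    assume ?L
    then obtain P M where "(\<Psi> \<longlongrightarrow> P) (at (of_real x) within upper_half_plane)"
      "(\<Psi> \<longlongrightarrow> M) (at (of_real x) within lower_half_plane)" "P = M ** (c *\<^sub>m \<sigma>\<^sub>1)"
      by (auto simp: has_jump_def)
    then show ?R
      unfolding mult
      by (intro exI[of _ "\<lambda>i j. P $ i $ j"] exI[of _ "\<lambda>i j. M $ i $ j"]) (auto intro!: tendsto_vec_nth)
  next
    assume ?R
    then obtain p m where
      "\<forall>i j. ((\<lambda>z. \<Psi> z $ i $ j) \<longlongrightarrow> p i j) (at (of_real x) within upper_half_plane)"
      "\<forall>i j. ((\<lambda>z. \<Psi> z $ i $ j) \<longlongrightarrow> m i j) (at (of_real x) within lower_half_plane)"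
      "\<forall>i. p i 1 = c * m i 2 \<and> p i 2 = c * m i 1"
      by blast
    then show ?L
      unfolding has_jump_def mult
      by (intro exI[of _ "\<chi> i j. p i j"] exI[of _ "\<chi> i j. m i j"]) (auto intro!: vec_tendstoI)
  qed
qed

text \<open>Writing the factor with \<open>sgn x\<close> lets both intervals be treated together, in
  the same form in which \<beta> jumps.\<close>

lemma jumps_iff:
  "(\<forall>x\<in>{-1<..<0}. has_jump \<Psi> ((- \<i>) *\<^sub>m \<sigma>\<^sub>1) x) \<and> (\<forall>x\<in>{0<..<1}. has_jump \<Psi> (\<i> *\<^sub>m \<sigma>\<^sub>1) x) \<longleftrightarrow>
    (\<forall>x\<in>{-1<..<1} - {0}. has_jump \<Psi> ((complex_of_real (sgn x) * \<i>) *\<^sub>m \<sigma>\<^sub>1) x)" (is "?L \<longleftrightarrow> ?R")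
proof
  assume L: ?L
  show ?R
  proof
    fix x :: real assume "x \<in> {-1<..<1} - {0}"
    then have "x \<in> {-1<..<0} \<or> x \<in> {0<..<1}" by auto
    then show "has_jump \<Psi> ((complex_of_real (sgn x) * \<i>) *\<^sub>m \<sigma>\<^sub>1) x" using L by auto
  qed
next
  assume R: ?R
  have "has_jump \<Psi> ((- \<i>) *\<^sub>m \<sigma>\<^sub>1) x" if "x \<in> {-1<..<0}" for x
    using R[rule_format, of x] that by simp
  moreover have "has_jump \<Psi> (\<i> *\<^sub>m \<sigma>\<^sub>1) x" if "x \<in> {0<..<1}" for x
    using R[rule_format, of x] that by simp
  ultimately show ?L by blast
qed

lemma norm_mat2_le:
  fixes A :: "complex^2^2"
  shows "norm A \<le> (\<Sum>i\<in>UNIV. \<Sum>j\<in>UNIV. norm (A $ i $ j))"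
proof -
  have "norm A \<le> (\<Sum>i\<in>UNIV. norm (A $ i))"
    unfolding norm_vec_def[of A] by (intro L2_set_le_sum) simp
  also have "\<dots> \<le> (\<Sum>i\<in>UNIV. \<Sum>j\<in>UNIV. norm (A $ i $ j))"
    by (intro sum_mono, subst norm_vec_def, intro L2_set_le_sum) simp
  finally show ?thesis .
qed

lemma bigo_norm_mat2_iff:
  fixes A :: "'a \<Rightarrow> complex^2^2"
  shows "(\<lambda>z. norm (A z)) \<in> O[F](g) \<longleftrightarrow> (\<forall>i j. (\<lambda>z. norm (A z $ i $ j)) \<in> O[F](g))"
proof (intro iffI allI)
  fix i j assume "(\<lambda>z. norm (A z)) \<in> O[F](g)"
  moreover have "norm (A z $ i $ j) \<le> norm (A z)" for z
    using Finite_Cartesian_Product.norm_nth_le[of "A z $ i" j]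
      Finite_Cartesian_Product.norm_nth_le[of "A z" i] by linarith
  then have "(\<lambda>z. norm (A z $ i $ j)) \<in> O[F](\<lambda>z. norm (A z))"
    by (intro landau_o.big_mono) auto
  ultimately show "(\<lambda>z. norm (A z $ i $ j)) \<in> O[F](g)"
    by (rule landau_o.big_trans[rotated])
next
  assume "\<forall>i j. (\<lambda>z. norm (A z $ i $ j)) \<in> O[F](g)"
  then have "(\<lambda>z. \<Sum>i\<in>UNIV. \<Sum>j\<in>UNIV. norm (A z $ i $ j)) \<in> O[F](g)"
    unfolding sum_2 by (intro sum_in_bigo) auto
  moreover have "(\<lambda>z. norm (A z)) \<in> O[F](\<lambda>z. \<Sum>i\<in>UNIV. \<Sum>j\<in>UNIV. norm (A z $ i $ j))"
    using norm_mat2_le by (intro landau_o.big_mono always_eventually allI) (simp add: sum_nonneg)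
  ultimately show "(\<lambda>z. norm (A z)) \<in> O[F](g)"
    by (rule landau_o.big_trans[rotated])
qed

text \<open>This is the first entry minus the second in row \<open>i\<close> of the identity matrix.
  It serves also as the sign of column \<open>j\<close> when entries are recovered from sums and
  differences.\<close>

abbreviation row_sign :: "2 \<Rightarrow> complex" where
  "row_sign i \<equiv> (if i = 1 then 1 else - 1)"

lemma eventually_off_cut: "\<forall>\<^sub>F z in at_infinity. z \<in> - branch_cut"
  unfolding eventually_at_infinity
proof (intro exI allI impI)
  fix z :: complex assume "2 \<le> norm z"
  then show "z \<in> - branch_cut"
    using cmod_eq_Re[of z] by (auto simp: in_cut_iff)
qed

lemma tendsto_of_bigo_inverse:
  assumes "(\<lambda>z. norm (f z - L)) \<in> O[at_infinity](\<lambda>z::complex. norm (inverse z))"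
  shows "(f \<longlongrightarrow> L) at_infinity"
proof -
  obtain C where "\<forall>\<^sub>F z in at_infinity. norm (norm (f z - L)) \<le> C * norm (norm (inverse z))"
    using assms by (elim landau_o.bigE)
  then have "\<forall>\<^sub>F z in at_infinity. norm (f z - L) \<le> C * norm (inverse z)"
    by simp
  moreover have "((\<lambda>z::complex. C * norm (inverse z)) \<longlongrightarrow> 0) at_infinity"
    using tendsto_inverse_0 by (intro tendsto_mult_right_zero tendsto_norm_zero)
  ultimately have "((\<lambda>z. f z - L) \<longlongrightarrow> 0) at_infinity"
    by (rule Lim_null_comparison)
  then show ?thesis by (simp add: LIM_zero_iff)
qed

text \<open>In the coordinate \<open>inverse z\<close> the function extends differentiably to
  \<open>0\<close>, so its difference quotient there is bounded. This upgrades a mere limit to the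
  rate that the normalisation demands.\<close>

lemma analytic_at_infinity_bigo:
  assumes an: "analytic_at_infinity f" and lim: "(f \<longlongrightarrow> L) at_infinity"
  shows "(\<lambda>z. norm (f z - L)) \<in> O[at_infinity](\<lambda>z. norm (inverse z))"
proof -
  obtain g where g: "g analytic_on {0}" and fg: "\<forall>\<^sub>F w in at 0. f (inverse w) = g w"
    using an by (auto simp: analytic_at_infinity_def)
  have inv: "filterlim inverse (at (0::complex)) at_infinity"
    using filterlim_def[of inverse "at (0::complex)" at_infinity] at_to_infinity[where 'a = complex]
    by simp
  have fg': "\<forall>\<^sub>F z in at_infinity. f z = g (inverse z)"
    using eventually_compose_filterlim[OF fg inv] by simp
  obtain D where D: "(g has_field_derivative D) (at 0)"
    using g analytic_on_imp_differentiable_at field_differentiable_def by blast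
  have "((\<lambda>w. (g w - g 0) / w) \<longlongrightarrow> D) (at 0)" and "(g \<longlongrightarrow> g 0) (at 0)"
    using D DERIV_isCont[OF D] by (simp_all add: has_field_derivative_iff isCont_def)
  from this[THEN filterlim_compose, OF inv]
  have quot: "((\<lambda>z. (g (inverse z) - g 0) / inverse z) \<longlongrightarrow> D) at_infinity"
    and lim_g: "((\<lambda>z. g (inverse z)) \<longlongrightarrow> g 0) at_infinity" .
  have "(f \<longlongrightarrow> g 0) at_infinity"
    using fg' by (intro Lim_transform_eventually[OF lim_g]) (auto elim: eventually_mono)
  then have L: "L = g 0"
    using lim by (intro tendsto_unique[OF trivial_limit_at_infinity])
  have "(\<lambda>z. g (inverse z) - g 0) \<in> O[at_infinity](inverse)"
    by (intro bigoI_tendsto[OF quot]) (auto intro: eventually_not_equal_at_infinity)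
  moreover have "\<forall>\<^sub>F z in at_infinity. f z - L = g (inverse z) - g 0"
    using fg' by eventually_elim (simp add: L)
  ultimately have "(\<lambda>z. f z - L) \<in> O[at_infinity](inverse)"
    by (simp add: landau_o.big.in_cong)
  then show ?thesis by simp
qed

lemma bigo_norm_powr:
  assumes "b \<le> a"
  shows "(\<lambda>z. norm (z - p) powr a) \<in> O[at p within S](\<lambda>z. norm (z - p) powr b)"
proof (intro landau_o.big_mono)
  have "\<forall>\<^sub>F z in at p within S. norm (z - p) < 1"
    by (auto simp: eventually_at dist_norm intro: exI[of _ 1])
  then show "\<forall>\<^sub>F z in at p within S. norm (norm (z - p) powr a) \<le> norm (norm (z - p) powr b)"
    by eventually_elim (use assms in \<open>simp add: powr_mono'\<close>)
qed

section \<open>Sums and differences within the rows\<close>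

text \<open>The matrix \<open>\<beta>_pow_\<sigma>\<^sub>1 z\<close> has eigenvectors
  \<open>(1, 1)\<close> and \<open>(1, -1)\<close> with eigenvalues \<open>\<beta> z\<close> and
  \<open>1 / \<beta> z\<close>, so sum and difference of a row diagonalise the product. The term
  with \<open>x\<close> and \<open>y\<close> cancels in the sum and doubles in the difference. Where
  a denominator is \<open>0\<close>, division has the value \<open>0\<close> on both sides, so
  \<open>z\<close> is arbitrary.\<close>

lemma \<beta>_pow_\<sigma>\<^sub>1_row_form_iff:
  fixes A :: "complex^2^2"
  shows "A = (mat 1 + (1 / z) *\<^sub>m mat2 x (- x) y (- y)) ** \<beta>_pow_\<sigma>\<^sub>1 z \<longleftrightarrow>
    (\<forall>i. A $ i $ 1 + A $ i $ 2 = \<beta> z \<and>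
      A $ i $ 1 - A $ i $ 2 = (row_sign i + 2 * (if i = 1 then x else y) / z) / \<beta> z)"
proof -
  define W where "W = (mat 1 + (1 / z) *\<^sub>m mat2 x (- x) y (- y)) ** \<beta>_pow_\<sigma>\<^sub>1 z"
  have W: "W $ i $ 1 + W $ i $ 2 = \<beta> z"
    "W $ i $ 1 - W $ i $ 2 = (row_sign i + 2 * (if i = 1 then x else y) / z) / \<beta> z" for i
  proof -
    define M where "M = (mat 1 + (1 / z) *\<^sub>m mat2 x (- x) y (- y) :: complex^2^2)"
    define b where "b = 1 / (2 * \<beta> z)"
    have entries: "W $ i $ 1 = M $ i $ 1 * (\<beta> z / 2 + b) + M $ i $ 2 * (\<beta> z / 2 - b)"
      "W $ i $ 2 = M $ i $ 1 * (\<beta> z / 2 - b) + M $ i $ 2 * (\<beta> z / 2 + b)"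
      by (simp_all add: W_def M_def b_def matrix_matrix_mult_def sum_2 \<beta>_pow_\<sigma>\<^sub>1_def mat2_def
        smult_mat_def)
    have M: "M $ i $ 1 + M $ i $ 2 = 1"
      "M $ i $ 1 - M $ i $ 2 = row_sign i + 2 * (if i = 1 then x else y) / z"
      using exhaust_2[of i] by (auto simp: M_def mat_def mat2_def smult_mat_def)
    have "W $ i $ 1 + W $ i $ 2 = (M $ i $ 1 + M $ i $ 2) * \<beta> z"
      unfolding entries by (simp add: algebra_simps)
    then show "W $ i $ 1 + W $ i $ 2 = \<beta> z"
      unfolding M by simp
    have "W $ i $ 1 - W $ i $ 2 = (M $ i $ 1 - M $ i $ 2) * (2 * b)"
      unfolding entries by (simp add: algebra_simps)
    then show "W $ i $ 1 - W $ i $ 2 = (row_sign i + 2 * (if i = 1 then x else y) / z) / \<beta> z"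
      unfolding M b_def by simp
  qed
  have eq: "a = c \<and> b = d \<longleftrightarrow> a + b = c + d \<and> a - b = c - d" for a b c d :: complex
  proof
    have *: "a = ((a + b) + (a - b)) / 2" "b = ((a + b) - (a - b)) / 2" for a b :: complex
      by (simp_all add: field_simps)
    assume "a + b = c + d \<and> a - b = c - d"
    then show "a = c \<and> b = d"
      using * by metis
  qed auto
  have "A = W \<longleftrightarrow> (\<forall>i. A $ i $ 1 = W $ i $ 1 \<and> A $ i $ 2 = W $ i $ 2)"
    by (simp add: vec_eq_iff forall_2)
  also have "\<dots> \<longleftrightarrow> (\<forall>i. A $ i $ 1 + A $ i $ 2 = W $ i $ 1 + W $ i $ 2 \<and>
      A $ i $ 1 - A $ i $ 2 = W $ i $ 1 - W $ i $ 2)"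
    by (rule all_cong1, rule eq)
  finally show ?thesis
    unfolding W unfolding W_def .
qed

section \<open>Necessity: the rows of a solution\<close>

text \<open>The jump exchanges the two entries of a row, so their combination with sign
  \<open>s\<close> is only multiplied by \<open>s * sgn x * \<i>\<close>, as
  \<open>\<beta>_power_int_quotient\<close> expects. The entries of \<open>mat 1\<close> enter as
  the values at infinity.\<close>

lemma solution_row:
  fixes \<Psi> :: "complex \<Rightarrow> complex^2^2"
  assumes sol: "solves_model_RHP \<Psi>" and s: "s = 1 \<or> s = -1"
  obtains c where
    "\<And>z. z \<in> - branch_cut \<Longrightarrow> \<Psi> z $ i $ 1 + of_int s * \<Psi> z $ i $ 2 =
      ((mat 1 :: complex^2^2) $ i $ 1 + of_int s * (mat 1 :: complex^2^2) $ i $ 2 + c / z) * \<beta> z powi s"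
    "s = 1 \<Longrightarrow> c = 0"
proof -
  let ?f = "\<lambda>z. \<Psi> z $ i $ 1 + of_int s * \<Psi> z $ i $ 2"
  have jumps: "\<forall>x\<in>{-1<..<1} - {0}. has_jump \<Psi> ((complex_of_real (sgn x) * \<i>) *\<^sub>m \<sigma>\<^sub>1) x"
    using sol unfolding jumps_iff[symmetric] solves_model_RHP_def by blast
  have holo: "?f holomorphic_on - branch_cut"
    using sol unfolding solves_model_RHP_def
    by (intro holomorphic_intros) (auto intro: analytic_imp_holomorphic)
  have jump: "\<exists>l. (?f \<longlongrightarrow> of_int s * (complex_of_real (sgn x) * \<i>) * l) (at (of_real x) within upper_half_plane) \<and>
      (?f \<longlongrightarrow> l) (at (of_real x) within lower_half_plane)"
    if x: "x \<in> {-1<..<1} - {0}" for x :: real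
  proof -
    let ?c = "complex_of_real (sgn x) * \<i>"
    obtain p m where up: "\<And>i j. ((\<lambda>z. \<Psi> z $ i $ j) \<longlongrightarrow> p i j) (at (of_real x) within upper_half_plane)"
      and low: "\<And>i j. ((\<lambda>z. \<Psi> z $ i $ j) \<longlongrightarrow> m i j) (at (of_real x) within lower_half_plane)"
      and pm: "\<And>i. p i 1 = ?c * m i 2" "\<And>i. p i 2 = ?c * m i 1"
      using jumps[rule_format, OF x] unfolding has_jump_iff by blast
    have "(?f \<longlongrightarrow> p i 1 + of_int s * p i 2) (at (of_real x) within upper_half_plane)"
      by (intro tendsto_intros up)
    \<comment> \<open>The exchange of the entries is undone by pulling out \<open>s\<close>, because
      \<open>s * s = 1\<close>.\<close>
    moreover have "p i 1 + of_int s * p i 2 = of_int s * ?c * (m i 1 + of_int s * m i 2)"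
      using s by (auto simp: pm algebra_simps)
    moreover have "(?f \<longlongrightarrow> m i 1 + of_int s * m i 2) (at (of_real x) within lower_half_plane)"
      by (intro tendsto_intros low)
    ultimately show ?thesis by auto
  qed
  have growth: "(\<lambda>z. norm (?f z)) \<in> O[F](g)" if "(\<lambda>z. norm (\<Psi> z)) \<in> O[F](g)" for F g
  proof -
    have entries: "(\<lambda>z. norm (\<Psi> z $ i $ j)) \<in> O[F](g)" for j
      using that by (simp add: bigo_norm_mat2_iff)
    have "(\<lambda>z. norm (?f z)) \<in> O[F](\<lambda>z. norm (\<Psi> z $ i $ 1) + norm (\<Psi> z $ i $ 2))"
    proof (intro landau_o.big_mono always_eventually allI)
      show "norm (norm (?f z)) \<le> norm (norm (\<Psi> z $ i $ 1) + norm (\<Psi> z $ i $ 2))" for z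
        using norm_triangle_ineq[of "\<Psi> z $ i $ 1" "of_int s * \<Psi> z $ i $ 2"] s
        by (auto simp: norm_mult)
    qed
    also have "(\<lambda>z. norm (\<Psi> z $ i $ 1) + norm (\<Psi> z $ i $ 2)) \<in> O[F](g)"
      by (intro sum_in_bigo entries)
    finally show ?thesis .
  qed
  have "(\<Psi> \<longlongrightarrow> mat 1) at_infinity"
    using sol by (intro tendsto_of_bigo_inverse) (simp add: solves_model_RHP_def)
  then have inf: "(?f \<longlongrightarrow> (mat 1 :: complex^2^2) $ i $ 1 + of_int s * (mat 1 :: complex^2^2) $ i $ 2) at_infinity"
    by (intro tendsto_intros)
  have "(\<lambda>z. norm (?f z)) \<in> O[at 1 within - branch_cut](\<lambda>z. norm (z - 1) powr (- 1 / 4))"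
    "(\<lambda>z. norm (?f z)) \<in> O[at (-1) within - branch_cut](\<lambda>z. norm (z - (-1)) powr (- 1 / 4))"
    "(\<lambda>z. norm (?f z)) \<in> O[at 0 within - branch_cut](\<lambda>z. norm (z - 0) powr (- 1 / 2))"
    using sol by (auto intro!: growth simp: solves_model_RHP_def)
  then show ?thesis
    using \<beta>_power_int_quotient[OF s holo jump _ _ _ inf] that by blast
qed

section \<open>Sufficiency: verification of the conditions\<close>

text \<open>Solving the two relations gives every entry as
  \<open>\<beta> z / 2 + q i j z / \<beta> z\<close>, and each condition is checked on this formula.
  The decay of \<open>1 / \<beta> z\<close> at \<open>0\<close> tempers the possible pole of
  \<open>q\<close> to the permitted exponent \<open>- 1 / 2\<close>, whatever the value of
  \<open>k\<close>.\<close>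

lemma solves_model_RHP_of_row_form:
  fixes \<Psi> :: "complex \<Rightarrow> complex^2^2" and k :: "2 \<Rightarrow> complex"
  assumes rows: "\<And>z i. z \<in> - branch_cut \<Longrightarrow> \<Psi> z $ i $ 1 + \<Psi> z $ i $ 2 = \<beta> z"
    "\<And>z i. z \<in> - branch_cut \<Longrightarrow> \<Psi> z $ i $ 1 - \<Psi> z $ i $ 2 = (row_sign i + k i / z) / \<beta> z"
  shows "solves_model_RHP \<Psi>"
proof -
  define q where "q = (\<lambda>i j z. row_sign j * (row_sign i + k i / z) / 2)"
  have halve: "(b + r * (t / c)) / 2 = b / 2 + r * t / 2 / c" for b c r t :: complex
    by (simp add: add_divide_distrib)
  have entry: "\<Psi> z $ i $ j = \<beta> z / 2 + q i j z / \<beta> z" if "z \<in> - branch_cut" for z i j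
  proof -
    have "\<Psi> z $ i $ j = ((\<Psi> z $ i $ 1 + \<Psi> z $ i $ 2) + row_sign j * (\<Psi> z $ i $ 1 - \<Psi> z $ i $ 2)) / 2"
      using exhaust_2[of j] by auto
    also have "\<dots> = \<beta> z / 2 + row_sign j * (row_sign i + k i / z) / 2 / \<beta> z"
      unfolding rows[OF that] by (rule halve)
    finally show ?thesis
      by (simp only: q_def)
  qed
  have off_cut_at: "\<forall>\<^sub>F z in at p within S. z \<in> - branch_cut" if "S \<subseteq> - branch_cut" for p S
    using that by (auto simp: eventually_at_filter intro!: always_eventually)
  have holo: "(\<lambda>z. \<Psi> z $ i $ j) analytic_on - branch_cut" for i j
  proof -
    have "(\<lambda>z. \<beta> z / 2 + q i j z / \<beta> z) analytic_on - branch_cut"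
      unfolding q_def using \<beta>_nonzero
      by (intro analytic_intros \<beta>_analytic) (auto simp: in_cut_iff)
    then have "(\<lambda>z. \<beta> z / 2 + q i j z / \<beta> z) holomorphic_on - branch_cut"
      by (rule analytic_imp_holomorphic)
    then have "(\<lambda>z. \<Psi> z $ i $ j) holomorphic_on - branch_cut"
      by (rule holomorphic_transform) (simp add: entry)
    then show ?thesis
      by (simp add: analytic_on_open open_Compl)
  qed
  have lim_inf: "((\<lambda>z. \<Psi> z $ i $ j) \<longlongrightarrow> (mat 1 :: complex^2^2) $ i $ j) at_infinity" for i j
  proof (rule Lim_transform_eventually)
    have "((\<lambda>z. \<beta> z / 2 + q i j z / \<beta> z) \<longlongrightarrow> 1 / 2 + (row_sign j * (row_sign i + 0) / 2) / 1) at_infinity"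
      unfolding q_def
      by (intro tendsto_intros \<beta>_tendsto_1 tendsto_divide_0[OF tendsto_const] filterlim_ident) auto
    then show "((\<lambda>z. \<beta> z / 2 + q i j z / \<beta> z) \<longlongrightarrow> (mat 1 :: complex^2^2) $ i $ j) at_infinity"
      using exhaust_2[of i] exhaust_2[of j] by (auto simp: mat_def)
    show "\<forall>\<^sub>F z in at_infinity. \<beta> z / 2 + q i j z / \<beta> z = \<Psi> z $ i $ j"
      using eventually_off_cut by eventually_elim (simp add: entry)
  qed
  have an_inf: "analytic_at_infinity (\<lambda>z. \<Psi> z $ i $ j)" for i j
    unfolding analytic_at_infinity_def
  proof (intro exI conjI)
    let ?b = "\<lambda>w::complex. (1 - w\<^sup>2) powr (1 / 4)"
    \<comment> \<open>In the coordinate \<open>w\<close> the term \<open>k i / z\<close> becomes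
      \<open>k i * w\<close>, so the formula for the entries continues analytically to
      \<open>w = 0\<close>.\<close>
    show "(\<lambda>w. ?b w / 2 + (row_sign j * (row_sign i + k i * w) / 2) / ?b w) analytic_on {0}"
      by (intro analytic_intros) auto
    have "filterlim inverse at_infinity (at (0::complex))"
      by (rule filterlim_inverse_at_infinity)
    then have "\<forall>\<^sub>F w in at (0::complex). inverse w \<in> - branch_cut"
      using eventually_compose_filterlim[OF eventually_off_cut] by blast
    moreover have "\<forall>\<^sub>F w in at (0::complex). w \<noteq> 0"
      by (simp add: eventually_at_filter)
    ultimately show "\<forall>\<^sub>F w in at 0. \<Psi> (inverse w) $ i $ j =
        ?b w / 2 + (row_sign j * (row_sign i + k i * w) / 2) / ?b w"
    proof eventually_elim
      case (elim w)
      then have "k i / inverse w = k i * w"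
        by (simp add: field_simps)
      then show ?case
        by (simp only: entry[OF elim(1)] \<beta>_inverse[OF elim(2)] q_def)
    qed
  qed
  have jump: "has_jump \<Psi> ((complex_of_real (sgn x) * \<i>) *\<^sub>m \<sigma>\<^sub>1) x" if x: "x \<in> {-1<..<1} - {0}" for x
  proof -
    let ?c = "complex_of_real (sgn x) * \<i>"
    obtain b where b: "b \<noteq> 0"
      "(\<beta> \<longlongrightarrow> ?c * b) (at (of_real x) within upper_half_plane)"
      "(\<beta> \<longlongrightarrow> b) (at (of_real x) within lower_half_plane)"
      using \<beta>_tendsto_cut[OF x] by blast
    have lim: "((\<lambda>z. \<Psi> z $ i $ j) \<longlongrightarrow> B / 2 + q i j x / B) (at (of_real x) within S)"
      if "(\<beta> \<longlongrightarrow> B) (at (of_real x) within S)" "B \<noteq> 0" "S \<subseteq> - branch_cut" for B S i j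
    proof (rule Lim_transform_eventually)
      show "((\<lambda>z. \<beta> z / 2 + q i j z / \<beta> z) \<longlongrightarrow> B / 2 + q i j x / B) (at (of_real x) within S)"
        unfolding q_def using x that(2) by (intro tendsto_intros that(1)) auto
      show "\<forall>\<^sub>F z in at (of_real x) within S. \<beta> z / 2 + q i j z / \<beta> z = \<Psi> z $ i $ j"
        using off_cut_at[OF that(3)] by eventually_elim (simp add: entry)
    qed
    have c: "?c = \<i> \<or> ?c = - \<i>" using x by (auto simp: sgn_if)
    have nz: "?c * b \<noteq> 0" using b(1) c by auto
    have sub: "upper_half_plane \<subseteq> - branch_cut" "lower_half_plane \<subseteq> - branch_cut"
      by (auto simp: in_cut_iff)
    \<comment> \<open>\<open>?c\<close> squares to \<open>-1\<close>, so dividing by it means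
      multiplying by \<open>- ?c\<close>. The sign is absorbed by the exchange of columns, since
      \<open>q\<close> changes sign with the column.\<close>
    have "?c * b / 2 + q i 1 x / (?c * b) = ?c * (b / 2 + q i 2 x / b)"
      "?c * b / 2 + q i 2 x / (?c * b) = ?c * (b / 2 + q i 1 x / b)" for i
    proof -
      have "t / (?c * b) = - (?c * (t / b))" for t
      proof -
        have "1 / ?c = - ?c" using c by (elim disjE) simp_all
        moreover have "t / (?c * b) = 1 / ?c * (t / b)" by simp
        ultimately show ?thesis by (metis mult_minus_left)
      qed
      moreover have "q i 2 x = - q i 1 x" by (simp add: q_def add_divide_distrib diff_divide_distrib)
      ultimately show "?c * b / 2 + q i 1 x / (?c * b) = ?c * (b / 2 + q i 2 x / b)"
        "?c * b / 2 + q i 2 x / (?c * b) = ?c * (b / 2 + q i 1 x / b)"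
        by (simp_all only: distrib_left minus_divide_left[symmetric] mult_minus_right
          times_divide_eq_right minus_minus)
    qed
    then show ?thesis
      unfolding has_jump_iff
      by (intro exI[of _ "\<lambda>i j. ?c * b / 2 + q i j x / (?c * b)"] exI[of _ "\<lambda>i j. b / 2 + q i j x / b"]
        conjI allI lim[OF b(2) nz sub(1)] lim[OF b(3) b(1) sub(2)])
  qed
  \<comment> \<open>Here \<open>a\<close> is the exponent of \<beta> at \<open>p\<close> and
    \<open>r\<close> bounds \<open>q\<close>. The two inequalities on \<open>e\<close> cover the
    summands \<open>\<beta> z / 2\<close> and \<open>q i j z / \<beta> z\<close>.\<close>
  have growth: "(\<lambda>z. norm (\<Psi> z)) \<in> O[at p within - branch_cut](\<lambda>z. norm (z - p) powr e)"
    if b: "\<And>s::int. (\<lambda>z. norm (\<beta> z powi s)) \<in> O[at p within - branch_cut](\<lambda>z. norm (z - p) powr (real_of_int s * a))"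
      and q: "\<And>i j. (\<lambda>z. norm (q i j z)) \<in> O[at p within - branch_cut](\<lambda>z. norm (z - p) powr r)"
      and e: "e \<le> a" "e \<le> r - a" for p :: complex and a r e :: real
    unfolding bigo_norm_mat2_iff
  proof (intro allI)
    fix i j
    have "(\<lambda>z. norm (\<Psi> z $ i $ j)) \<in>
        O[at p within - branch_cut](\<lambda>z. norm (\<beta> z powi 1) + norm (q i j z) * norm (\<beta> z powi (- 1)))"
    proof (intro landau_o.big_mono)
      have bound: "norm (\<Psi> z $ i $ j) \<le> norm (\<beta> z powi 1) + norm (q i j z) * norm (\<beta> z powi (- 1))"
        if "z \<in> - branch_cut" for z
      proof -
        have "\<Psi> z $ i $ j = \<beta> z / 2 + q i j z * \<beta> z powi (- 1)"
          unfolding entry[OF that] by (simp add: power_int_minus_divide)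
        also have "norm \<dots> \<le> norm (\<beta> z / 2) + norm (q i j z) * norm (\<beta> z powi (- 1))"
          unfolding norm_mult[symmetric] by (rule norm_triangle_ineq)
        also have "norm (\<beta> z / 2) \<le> norm (\<beta> z powi 1)"
          by (simp add: norm_divide)
        finally show ?thesis by simp
      qed
      show "\<forall>\<^sub>F z in at p within - branch_cut. norm (norm (\<Psi> z $ i $ j)) \<le>
          norm (norm (\<beta> z powi 1) + norm (q i j z) * norm (\<beta> z powi (- 1)))"
        using off_cut_at[OF order_refl]
      proof eventually_elim
        case (elim z)
        from bound[OF elim] show ?case by simp
      qed
    qed
    also have "\<dots> \<subseteq> O[at p within - branch_cut](\<lambda>z. norm (z - p) powr e)"
    proof (intro landau_o.big_subsetI sum_in_bigo)
      show "(\<lambda>z. norm (\<beta> z powi 1)) \<in> O[at p within - branch_cut](\<lambda>z. norm (z - p) powr e)"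
        using landau_o.big_trans[OF b[of 1] bigo_norm_powr] e by simp
      have "(\<lambda>z. norm (q i j z) * norm (\<beta> z powi (- 1)))
          \<in> O[at p within - branch_cut](\<lambda>z. norm (z - p) powr r * norm (z - p) powr (real_of_int (- 1) * a))"
        by (intro landau_o.big.mult b q)
      then have "(\<lambda>z. norm (q i j z) * norm (\<beta> z powi (- 1)))
          \<in> O[at p within - branch_cut](\<lambda>z. norm (z - p) powr (r - a))"
        by (simp flip: powr_add)
      then show "(\<lambda>z. norm (q i j z) * norm (\<beta> z powi (- 1)))
          \<in> O[at p within - branch_cut](\<lambda>z. norm (z - p) powr e)"
        using landau_o.big_trans bigo_norm_powr[OF e(2)] by blast
    qed
    finally show "(\<lambda>z. norm (\<Psi> z $ i $ j)) \<in> O[at p within - branch_cut](\<lambda>z. norm (z - p) powr e)" .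
  qed
  have q_away: "(\<lambda>z. norm (q i j z)) \<in> O[at p within S](\<lambda>z. norm (z - p) powr 0)" if "p \<noteq> 0" for i j p S
  proof (rule bigoI_tendsto)
    have "((\<lambda>z. norm (q i j z)) \<longlongrightarrow> norm (q i j p)) (at p within S)"
      unfolding q_def using that by (intro tendsto_intros) auto
    then show "((\<lambda>z. norm (q i j z) / norm (z - p) powr 0) \<longlongrightarrow> norm (q i j p)) (at p within S)"
      by (rule Lim_transform_eventually) (auto simp: eventually_at_filter)
  qed (simp add: eventually_at_filter)
  have q_0: "(\<lambda>z. norm (q i j z)) \<in> O[at 0 within S](\<lambda>z. norm (z - 0) powr (- 1))" for i j S
  proof (rule bigoI_tendsto)
    let ?r = "\<lambda>z. row_sign j * (row_sign i * z + k i) / 2"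
    have "((\<lambda>z. norm (?r z)) \<longlongrightarrow> norm (?r 0)) (at 0 within S)"
      by (intro tendsto_intros) auto
    moreover have "\<forall>\<^sub>F z in at 0 within S. norm (?r z) = norm (q i j z) / norm (z - 0) powr (- 1)"
      unfolding eventually_at_filter
    proof (intro always_eventually allI impI)
      fix z :: complex assume "z \<noteq> 0"
      then have "?r z = q i j z * z" by (simp add: q_def field_simps)
      then show "norm (?r z) = norm (q i j z) / norm (z - 0) powr (- 1)"
        by (simp add: norm_mult powr_minus_divide)
    qed
    ultimately show "((\<lambda>z. norm (q i j z) / norm (z - 0) powr (- 1)) \<longlongrightarrow> norm (?r 0)) (at 0 within S)"
      by (rule Lim_transform_eventually)
  qed (simp add: eventually_at_filter)
  note \<beta>_growth = bigtheta_\<beta>_power_int[where S = "- branch_cut", THEN bigthetaD1]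
  \<comment> \<open>At \<open>\<plusminus>1\<close> the reciprocal is decisive, with
    \<open>r - a = - 1 / 4\<close>; at \<open>0\<close> both \<open>a\<close> and
    \<open>r - a\<close> equal \<open>- 1 / 2\<close>.\<close>
  have "(\<lambda>z. norm (\<Psi> z)) \<in> O[at 1 within - branch_cut](\<lambda>z. norm (z - 1) powr (- 1 / 4))"
    using \<beta>_growth(1) by (intro growth[where a = "1 / 4" and r = 0] q_away) simp_all
  moreover have "(\<lambda>z. norm (\<Psi> z)) \<in> O[at (-1) within - branch_cut](\<lambda>z. norm (z - (-1)) powr (- 1 / 4))"
    using \<beta>_growth(2) by (intro growth[where a = "1 / 4" and r = 0] q_away) simp_all
  moreover have "(\<lambda>z. norm (\<Psi> z)) \<in> O[at 0 within - branch_cut](\<lambda>z. norm (z - 0) powr (- 1 / 2))"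
    using \<beta>_growth(3) by (intro growth[where a = "- 1 / 2" and r = "- 1"] q_0) simp_all
  moreover have "(\<lambda>z. norm (\<Psi> z - mat 1)) \<in> O[at_infinity](\<lambda>z. norm (inverse z))"
    unfolding bigo_norm_mat2_iff using analytic_at_infinity_bigo[OF an_inf lim_inf] by simp
  moreover have "(\<forall>x\<in>{-1<..<0}. has_jump \<Psi> ((- \<i>) *\<^sub>m \<sigma>\<^sub>1) x) \<and> (\<forall>x\<in>{0<..<1}. has_jump \<Psi> (\<i> *\<^sub>m \<sigma>\<^sub>1) x)"
    unfolding jumps_iff using jump by blast
  ultimately show ?thesis
    unfolding solves_model_RHP_def using holo an_inf by simp
qed

theorem theorem5p15:
  fixes \<Psi> :: "complex \<Rightarrow> complex^2^2"
  shows "solves_model_RHP \<Psi> \<longleftrightarrow>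
    (\<exists>x y :: complex. \<forall>z\<in>- branch_cut.
       \<Psi> z = (mat 1 + (1 / z) *\<^sub>m mat2 x (- x) y (- y)) ** \<beta>_pow_\<sigma>\<^sub>1 z)"
proof
  assume sol: "solves_model_RHP \<Psi>"
  have "\<exists>k. \<forall>z\<in>- branch_cut. \<Psi> z $ i $ 1 + \<Psi> z $ i $ 2 = \<beta> z \<and>
      \<Psi> z $ i $ 1 - \<Psi> z $ i $ 2 = (row_sign i + 2 * k / z) / \<beta> z" for i
  proof -
    obtain c where c: "\<And>z. z \<in> - branch_cut \<Longrightarrow> \<Psi> z $ i $ 1 + of_int 1 * \<Psi> z $ i $ 2 =
        ((mat 1 :: complex^2^2) $ i $ 1 + of_int 1 * (mat 1 :: complex^2^2) $ i $ 2 + c / z) * \<beta> z powi 1" "c = 0"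
      using solution_row[OF sol, of 1 i] by auto
    obtain d where d: "\<And>z. z \<in> - branch_cut \<Longrightarrow> \<Psi> z $ i $ 1 + of_int (- 1) * \<Psi> z $ i $ 2 =
        ((mat 1 :: complex^2^2) $ i $ 1 + of_int (- 1) * (mat 1 :: complex^2^2) $ i $ 2 + d / z) * \<beta> z powi (- 1)"
      using solution_row[OF sol, of "- 1" i] by auto
    show ?thesis
    proof (intro exI ballI conjI)
      fix z assume z: "z \<in> - branch_cut"
      show "\<Psi> z $ i $ 1 + \<Psi> z $ i $ 2 = \<beta> z"
        using c(1)[OF z] c(2) exhaust_2[of i] by (auto simp: mat_def)
      \<comment> \<open>The witness is half the constant from \<open>solution_row\<close>, because a
        row \<open>(x, - x)\<close> contributes \<open>2 * x\<close> to the difference.\<close>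
      show "\<Psi> z $ i $ 1 - \<Psi> z $ i $ 2 = (row_sign i + 2 * (d / 2) / z) / \<beta> z"
      proof -
        have "(mat 1 :: complex^2^2) $ i $ 1 + of_int (- 1) * (mat 1 :: complex^2^2) $ i $ 2 = row_sign i"
          using exhaust_2[of i] by (auto simp: mat_def)
        then have "\<Psi> z $ i $ 1 + of_int (- 1) * \<Psi> z $ i $ 2 = (row_sign i + d / z) * \<beta> z powi (- 1)"
          using d[OF z] by (simp only:)
        then show ?thesis
          by (simp add: power_int_minus_divide)
      qed
    qed
  qed
  \<comment> \<open>The constant depends on the row; its values for rows \<open>1\<close> and
    \<open>2\<close> become \<open>x\<close> and \<open>y\<close>.\<close>
  then obtain k where "\<And>i z. z \<in> - branch_cut \<Longrightarrow> \<Psi> z $ i $ 1 + \<Psi> z $ i $ 2 = \<beta> z \<and>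
      \<Psi> z $ i $ 1 - \<Psi> z $ i $ 2 = (row_sign i + 2 * k i / z) / \<beta> z"
    by metis
  then have "\<forall>z\<in>- branch_cut.
      \<Psi> z = (mat 1 + (1 / z) *\<^sub>m mat2 (k 1) (- k 1) (k 2) (- k 2)) ** \<beta>_pow_\<sigma>\<^sub>1 z"
    using \<beta>_pow_\<sigma>\<^sub>1_row_form_iff by (simp add: forall_2)
  then show "\<exists>x y. \<forall>z\<in>- branch_cut.
      \<Psi> z = (mat 1 + (1 / z) *\<^sub>m mat2 x (- x) y (- y)) ** \<beta>_pow_\<sigma>\<^sub>1 z"
    by blast
next
  assume "\<exists>x y. \<forall>z\<in>- branch_cut.
      \<Psi> z = (mat 1 + (1 / z) *\<^sub>m mat2 x (- x) y (- y)) ** \<beta>_pow_\<sigma>\<^sub>1 z"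
  then obtain x y where "\<forall>z\<in>- branch_cut.
      \<Psi> z = (mat 1 + (1 / z) *\<^sub>m mat2 x (- x) y (- y)) ** \<beta>_pow_\<sigma>\<^sub>1 z"
    by blast
  then show "solves_model_RHP \<Psi>"
    using \<beta>_pow_\<sigma>\<^sub>1_row_form_iff
    by (intro solves_model_RHP_of_row_form[where k = "\<lambda>i. 2 * (if i = 1 then x else y)"]) auto
qed

end
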